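(* Let $H_1, H_2$ be two different two-dimensional linear subspaces of $\mathbb{R}^3$, let $\mathbf{v}_1,\dots,\mathbf{v}_n \in H_1$ and $\mathbf{w}_1,\dots,\mathbf{w}_m \in H_2$, and let $P = [\mathbf{v}_1]+\cdots+[\mathbf{v}_n]+[\mathbf{w}_1]+\cdots+[\mathbf{w}_m]$ (Minkowski sum), a two-flat zonotope in $\mathbb{R}^3$. Suppose the additive group generated by $\mathbf{v}_1,\dots,\mathbf{v}_n,\mathbf{w}_1,\dots,\mathbf{w}_m$ is discrete and that $\mathbf{v}_1,\dots,\mathbf{v}_n$ span $H_1$. Then there exist a positive integer $K$ and a discrete multiset $\Lambda \subseteq \mathbb{R}^3$ such that $\sum_{\lambda\in\Lambda}\mathbf{1}_{P+\lambda}(x) = K$ for almost every $x$, and $\Lambda$ is not a finite union of translated lattices.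
   Context: $[\mathbf{v}]$ denotes the segment from $0$ to $\mathbf{v}$. A lattice here means a discrete additive subgroup of $\mathbb{R}^3$ of rank $3$.
   Formalization: The zonotope P is assumed to be full-dimensional (three-dimensional); otherwise, for example if all w_j lie in H_1, P has measure zero and no positive K can exist. *)

theory Defs
  imports "HOL-Analysis.Analysis" "HOL-Library.Set_Algebras"
begin

text \<open>
  A real vector space is regarded as a module over the integers. For this scaling
  \<open>int_module.subspace\<close> means "additive subgroup", \<open>int_module.span S\<close> is the additive group
  generated by \<open>S\<close>, and \<open>int_module.independent\<close> is linear independence over the integers.
\<close>

definition int_scale :: "int \<Rightarrow> 'a::real_vector \<Rightarrow> 'a" where
  "int_scale k x = of_int k *\<^sub>R x"

global_interpretation int_module: module int_scale
  by unfold_locales (simp_all add: int_scale_def algebra_simps)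

text \<open>Rank of a free abelian group: the cardinality of a basis over the integers.\<close>

definition has_free_rank :: "'a::real_vector set \<Rightarrow> nat \<Rightarrow> bool" where
  "has_free_rank G r \<longleftrightarrow>
     (\<exists>B. finite B \<and> card B = r \<and> int_module.independent B \<and> int_module.span B = G)"

definition is_lattice :: "(real^3) set \<Rightarrow> bool" where
  "is_lattice L \<longleftrightarrow> int_module.subspace L \<and> discrete L \<and> has_free_rank L 3"

text \<open>
  Infinite multisets of points are represented by their multiplicity functions; the sum over
  such a multiset weights each point by its multiplicity, and the union of multisets adds
  multiplicities. A multiset is discrete if it has only finitely many elements, counted with
  multiplicity, in every bounded set.
\<close>

definition discrete_mult :: "(real^3 \<Rightarrow> nat) \<Rightarrow> bool" where
  "discrete_mult \<Lambda> \<longleftrightarrow> (\<forall>B. bounded B \<longrightarrow> finite {x \<in> B. \<Lambda> x > 0})"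

definition finite_union_of_translated_lattices :: "(real^3 \<Rightarrow> nat) \<Rightarrow> bool" where
  "finite_union_of_translated_lattices \<Lambda> \<longleftrightarrow>
     (\<exists>(N::nat) t L. (\<forall>i<N. is_lattice (L i)) \<and>
        (\<forall>x. \<Lambda> x = (\<Sum>i<N. indicator ((+) (t i) ` L i) x)))"

definition covers_with_multiplicity :: "(real^3) set \<Rightarrow> (real^3 \<Rightarrow> nat) \<Rightarrow> nat \<Rightarrow> bool" where
  "covers_with_multiplicity P \<Lambda> K \<longleftrightarrow>
     (AE x in lebesgue.
        ((\<lambda>l. real (\<Lambda> l) * indicator ((+) l ` P) x) has_sum real K) UNIV)"

text \<open>The sums below are Minkowski sums of segments; an empty sum is the set \<open>{0}\<close>.\<close>

definition two_family_zonotope ::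
    "nat \<Rightarrow> (nat \<Rightarrow> real^3) \<Rightarrow> nat \<Rightarrow> (nat \<Rightarrow> real^3) \<Rightarrow> (real^3) set" where
  "two_family_zonotope n v m w =
     (\<Sum>i\<in>{1..n}. closed_segment 0 (v i)) + (\<Sum>j\<in>{1..m}. closed_segment 0 (w j))"

end

theory Submission
  imports Defs
begin

text \<open>
  Let \<open>L\<close> be the group generated by all \<open>v i\<close>, \<open>w j\<close> and \<open>L1 \<subseteq> L \<inter> H\<^sub>1\<close> the one generated by the \<open>v i\<close>.
  Adding a segment \<open>[v]\<close> with \<open>v \<in> L\<close> to a compact convex set \<open>Z\<close> increases the number of points
  \<open>l\<close> of \<open>L\<close> with \<open>x - l \<in> Z\<close> by the number of cosets \<open>l + \<int>v\<close> with \<open>x - l \<in> Z + \<real>v\<close>; iterating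
  this modulo larger and larger subgroups shows that \<open>P + L\<close> is a multiple tiling. The increment is
  invariant under translation along \<open>v\<close>. Hence, for arbitrary reals \<open>s i\<close> and
  \<open>q S = (\<Sum>i\<in>S. s i *\<^sub>R v i)\<close>, the alternating sum over \<open>S\<close> of the multiplicities of
  \<open>P + q S + L1\<close> does not change when the segments \<open>[v i]\<close> are dropped from \<open>P\<close>, and it vanishes
  almost everywhere because \<open>[w 1] + \<dots> + [w m]\<close> is a null set.

  So in the union of the multiple tilings \<open>P + q S + L\<close>, \<open>card S\<close> odd, the single layers \<open>q S + L1\<close>
  may be exchanged for the layers \<open>q S + L1\<close>, \<open>card S\<close> even. For generic \<open>s\<close> the origin lies in
  none of the \<open>q S + L\<close> with \<open>card S\<close> odd, so a lattice through the origin cannot be contained in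
  the result: it has a point \<open>u \<notin> H\<^sub>1\<close>, and by the pigeonhole principle two multiples of \<open>u\<close> lie in
  the same \<open>q S + L\<close>; their difference is a multiple of \<open>u\<close> in \<open>L\<close> that also lies in some
  \<open>q T + L\<close>, whence \<open>q T \<in> L\<close>.
\<close>

section \<open>Integer spans, their cosets and cylinders\<close>

lemma zspan_subset_span: "int_module.span B \<subseteq> span B"
proof (rule int_module.span_minimal)
  show "int_module.subspace (span B)"
    by (auto simp: int_module.subspace_def int_scale_def span_zero span_add span_scale)
qed (rule span_superset)

lemma zspan_translate_eq_iff:
  "(+) l ` int_module.span B = (+) l' ` int_module.span B \<longleftrightarrow> l - l' \<in> int_module.span B"
proof
  assume eq: "(+) l ` int_module.span B = (+) l' ` int_module.span B"
  have "l \<in> (+) l ` int_module.span B"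
    using int_module.span_zero[of B] by force
  then show "l - l' \<in> int_module.span B"
    unfolding eq by auto
next
  assume d: "l - l' \<in> int_module.span B"
  have *: "(+) a ` int_module.span B \<subseteq> (+) b ` int_module.span B"
    if "a - b \<in> int_module.span B" for a b
  proof clarify
    fix g assume "g \<in> int_module.span B"
    then have "(a - b) + g \<in> int_module.span B"
      using that by (rule_tac int_module.span_add)
    moreover have "a + g = b + ((a - b) + g)" by simp
    ultimately show "a + g \<in> (+) b ` int_module.span B" by blast
  qed
  have "l' - l \<in> int_module.span B"
    using int_module.span_neg[OF d] by simp
  then show "(+) l ` int_module.span B = (+) l' ` int_module.span B"
    using * d by blast
qed

lemma mem_plus_span_cong:
  assumes "x - y \<in> span B"
  shows "x \<in> Z + span B \<longleftrightarrow> y \<in> Z + span B"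
proof -
  have *: "b \<in> Z + span B" if "a \<in> Z + span B" "a - b \<in> span B" for a b
  proof -
    from that(1) obtain z h where "z \<in> Z" "h \<in> span B" "a = z + h"
      by (auto elim: set_plus_elim)
    then have "b = z + (h - (a - b))" by simp
    with \<open>z \<in> Z\<close> \<open>h \<in> span B\<close> that(2) show ?thesis
      by (metis set_plus_intro span_diff)
  qed
  have "y - x \<in> span B"
    using span_neg[OF assms] by simp
  then show ?thesis using * assms by blast
qed

section \<open>Sums of segments, and lines through convex sets\<close>

lemma compact_set_plus:
  fixes A B :: "'a::real_normed_vector set"
  assumes "compact A" "compact B"
  shows "compact (A + B)"
proof -
  have "A + B = {x + y | x y. x \<in> A \<and> y \<in> B}"
    by (auto simp: set_plus_def)
  then show ?thesis using compact_sums[OF assms] by simp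
qed

lemma compact_segment_sum:
  fixes u :: "'i \<Rightarrow> 'a::real_normed_vector"
  shows "compact (\<Sum>i\<in>J. closed_segment 0 (u i))"
  by (induction J rule: infinite_finite_induct) (auto intro: compact_set_plus)

lemma convex_segment_sum:
  fixes u :: "'i \<Rightarrow> 'a::real_normed_vector"
  shows "convex (\<Sum>i\<in>J. closed_segment 0 (u i))"
  by (rule convex_set_sum) auto

lemma mem_segment_plus_iff:
  "y \<in> X + closed_segment 0 v \<longleftrightarrow> (\<exists>s. 0 \<le> s \<and> s \<le> 1 \<and> y - s *\<^sub>R v \<in> X)"
  by (force simp: set_plus_def closed_segment_def algebra_simps)

text \<open>
  On a line in direction \<open>v\<close>, the convex set \<open>X\<close> cuts out a compact interval; adding the segment
  \<open>[v]\<close> lengthens it by one unit, so it catches exactly one more integer point.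
\<close>

lemma unique_new_integer_point:
  fixes X :: "'a::euclidean_space set"
  assumes X: "convex X" "closed X"
    and bdd: "\<And>t. y - t *\<^sub>R v \<in> X \<Longrightarrow> \<bar>t\<bar> \<le> C" and ne: "y - t0 *\<^sub>R v \<in> X"
  shows "\<exists>!k::int. y - of_int k *\<^sub>R v \<in> X + closed_segment 0 v \<and> y - of_int k *\<^sub>R v \<notin> X"
proof -
  define T where "T = {t. y - t *\<^sub>R v \<in> X}"
  have T: "T = (\<lambda>t. y - t *\<^sub>R v) -` X"
    by (auto simp: T_def)
  have "closed T"
    unfolding T by (intro continuous_closed_vimage X(2)) (auto intro!: continuous_intros)
  have segT: "b \<in> T" if "a \<in> T" "c \<in> T" "a \<le> b" "b \<le> c" for a b c
  proof (cases "a = c")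
    case False
    then have ac: "a < c" using that by simp
    define r where "r = (b - a) / (c - a)"
    have r: "0 \<le> r" "r \<le> 1" using that ac by (auto simp: r_def field_simps)
    have "r * (c - a) = b - a" using ac by (simp add: r_def)
    then have "b = (1 - r) * a + r * c" by (simp add: algebra_simps)
    moreover have "y - ((1 - r) * a + r * c) *\<^sub>R v =
        (1 - r) *\<^sub>R (y - a *\<^sub>R v) + r *\<^sub>R (y - c *\<^sub>R v)"
      by (simp add: algebra_simps)
    ultimately have "y - b *\<^sub>R v = (1 - r) *\<^sub>R (y - a *\<^sub>R v) + r *\<^sub>R (y - c *\<^sub>R v)"
      by metis
    also have "\<dots> \<in> X"
      using X(1) r that by (auto simp: convex_alt T_def)
    finally show ?thesis by (simp add: T_def)
  qed (use that in auto)
  have bb: "bdd_below T"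
    using bdd by (intro bdd_belowI[of _ "-C"]) (force simp: T_def)
  have "T \<noteq> {}" using ne by (auto simp: T_def)
  define a where "a = Inf T"
  have aT: "a \<in> T"
    unfolding a_def using closed_contains_Inf[OF \<open>T \<noteq> {}\<close> bb \<open>closed T\<close>] .
  have aI: "a \<le> t" if "t \<in> T" for t
    unfolding a_def using bb that by (rule cInf_lower[rotated])
  \<comment> \<open>The claim in terms of the parameter set \<open>T\<close>: \<open>k\<close> lies
    outside \<open>T\<close>, but the closed unit interval starting at \<open>k\<close> meets
    it.\<close>
  define Q where "Q k \<longleftrightarrow> (\<exists>s. 0 \<le> s \<and> s \<le> 1 \<and> of_int k + s \<in> T) \<and> of_int k \<notin> T" for k :: int
  have Q: "y - of_int k *\<^sub>R v \<in> X + closed_segment 0 v \<and> y - of_int k *\<^sub>R v \<notin> X \<longleftrightarrow> Q k" for k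
    by (simp add: mem_segment_plus_iff Q_def T_def algebra_simps)
  \<comment> \<open>The witness is the largest integer strictly below the left end \<open>a\<close>
    of \<open>T\<close>; this choice also covers integral \<open>a\<close>.\<close>
  have "Q (\<lceil>a\<rceil> - 1)"
  proof -
    have "a - of_int (\<lceil>a\<rceil> - 1) \<ge> 0" "a - of_int (\<lceil>a\<rceil> - 1) \<le> 1" "of_int (\<lceil>a\<rceil> - 1) < a"
      by linarith+
    moreover have "of_int (\<lceil>a\<rceil> - 1) \<notin> T"
      using aI calculation(3) by fastforce
    ultimately show ?thesis
      unfolding Q_def using aT by (intro conjI exI[of _ "a - of_int (\<lceil>a\<rceil> - 1)"]) auto
  qed
  \<comment> \<open>Here \<open>k + s\<close> and \<open>k' + s'\<close> lie in the interval
    \<open>T\<close> and enclose \<open>k'\<close>, which is supposed to lie outside.\<close>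
  moreover have False if "Q k" "Q k'" "k < k'" for k k'
  proof -
    obtain s s' where s: "s \<le> 1" "of_int k + s \<in> T" "0 \<le> s'" "of_int k' + s' \<in> T"
      using \<open>Q k\<close> \<open>Q k'\<close> by (auto simp: Q_def)
    have "real_of_int k + 1 \<le> of_int k'" using \<open>k < k'\<close> by linarith
    then have "of_int k' \<in> T" using segT[OF s(2) s(4)] s by auto
    with \<open>Q k'\<close> show False by (simp add: Q_def)
  qed
  ultimately have "\<exists>!k. Q k"
    by (metis linorder_neqE)
  then show ?thesis by (simp add: Q)
qed

section \<open>Cylinders over linear spans\<close>

lemma closed_plus_span:
  fixes Z :: "'a::euclidean_space set"
  assumes "compact Z"
  shows "closed (Z + span B)"
proof -
  have "Z + span B = (\<Union>x\<in>Z. \<Union>y\<in>span B. {x + y})"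
    by (auto simp: set_plus_def)
  then show ?thesis using compact_closed_sums[OF assms closed_span] by simp
qed

lemma convex_plus_span: "convex Z \<Longrightarrow> convex (Z + span B)"
  by (simp add: convex_set_plus subspace_imp_convex)

text \<open>A linear functional equal to 1 at \<open>v\<close> and 0 on \<open>span B\<close> is
  bounded on the cylinder, whereas along the line it changes at unit speed.\<close>

lemma line_meets_cylinder_bounded:
  fixes Z :: "'a::euclidean_space set"
  assumes "bounded Z" "v \<notin> span B"
  obtains C where "\<And>t. y - t *\<^sub>R v \<in> Z + span B \<Longrightarrow> \<bar>t\<bar> \<le> C"
proof -
  obtain B' where B': "B' \<subseteq> B" "independent B'" "span B' = span B"
    using maximal_independent_subset[of B] by (metis span_eq span_superset subset_trans)
  have ind: "independent (insert v B')"
    using B' assms(2) by (simp add: independent_insert)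
  obtain f :: "'a \<Rightarrow> real" where f: "linear f" "\<forall>x\<in>insert v B'. f x = (if x = v then 1 else 0)"
    using linear_independent_extend[OF ind, of "\<lambda>x. if x = v then 1 else 0"] by blast
  have "v \<notin> B'" using assms(2) B' span_superset[of B'] by auto
  then have fB: "f x = 0" if "x \<in> B'" for x
    using that f(2) by auto
  have f0: "f x = 0" if "x \<in> span B" for x
    using linear_eq_0_on_span[OF f(1) fB] that B'(3) by blast
  obtain R where R: "\<And>z. z \<in> Z \<Longrightarrow> norm (f z) \<le> R"
    using bounded_linear_image[OF assms(1), of f] f(1)
    by (auto simp: bounded_iff linear_conv_bounded_linear)
  have "\<bar>t\<bar> \<le> \<bar>f y\<bar> + R" if "y - t *\<^sub>R v \<in> Z + span B" for t
  proof -
    obtain z h where zh: "z \<in> Z" "h \<in> span B" "y - t *\<^sub>R v = z + h"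
      using \<open>y - t *\<^sub>R v \<in> Z + span B\<close> by (auto elim: set_plus_elim)
    have "f (y - t *\<^sub>R v) = f z"
      using zh f0 by (simp add: linear_add[OF f(1)])
    then have "f y - t = f z"
      using f by (simp add: linear_diff linear_cmul)
    then show ?thesis using R[OF zh(1)] by auto
  qed
  then show ?thesis by (rule that)
qed

section \<open>Cosets hit by a cylinder\<close>

text \<open>
  Counting cosets of the group generated by \<open>B\<close> itself, rather than of its saturation
  \<open>L \<inter> span B\<close>, avoids indices in the recursion for \<open>Z + [v]\<close>.
\<close>

definition hit_cosets :: "'a::real_vector set \<Rightarrow> 'a set \<Rightarrow> 'a set \<Rightarrow> 'a \<Rightarrow> 'a set set" where
  "hit_cosets L B Z x = (\<lambda>l. (+) l ` int_module.span B) ` {l \<in> L. x - l \<in> Z + span B}"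

lemma hit_cosets_absorb:
  assumes "v \<in> span B"
  shows "hit_cosets L B (Z + closed_segment 0 v) x = hit_cosets L B Z x"
proof -
  have "closed_segment 0 v + span B = span B"
  proof
    show "closed_segment 0 v + span B \<subseteq> span B"
      using assms by (auto simp: set_plus_def closed_segment_def intro: span_add span_scale)
    show "span B \<subseteq> closed_segment 0 v + span B"
      by (rule set_zero_plus2) auto
  qed
  then show ?thesis by (simp add: hit_cosets_def add.assoc)
qed

text \<open>The invariance holds for real, not only integer, combinations of \<open>B\<close>; this
  is what later permits shifts with arbitrary coefficients \<open>s i\<close>.\<close>

lemma hit_cosets_translate:
  assumes "h \<in> span B"
  shows "hit_cosets L B Z (x + h) = hit_cosets L B Z x"
proof -
  have "x + h - l \<in> Z + span B \<longleftrightarrow> x - l \<in> Z + span B" for l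
    by (rule mem_plus_span_cong) (simp add: assms)
  then show ?thesis by (simp add: hit_cosets_def)
qed

text \<open>Being hit does not depend on the representative: two of them differ by an element of
  \<open>span B\<close>, which the cylinder absorbs.\<close>

lemma mem_hit_cosets_iff:
  assumes "l \<in> L"
  shows "(+) l ` int_module.span B \<in> hit_cosets L B Z x \<longleftrightarrow> x - l \<in> Z + span B"
proof
  assume "(+) l ` int_module.span B \<in> hit_cosets L B Z x"
  then obtain l' where l': "x - l' \<in> Z + span B" "l - l' \<in> int_module.span B"
    by (auto simp: hit_cosets_def zspan_translate_eq_iff)
  then have "(x - l') - (x - l) \<in> span B"
    using zspan_subset_span[of B] by auto
  then show "x - l \<in> Z + span B"
    using l'(1) mem_plus_span_cong by blast
qed (use assms in \<open>auto simp: hit_cosets_def\<close>)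

text \<open>The terms for \<open>S\<close> and \<open>insert a S\<close> have opposite signs and
  cancel in pairs.\<close>

lemma alternating_sum_Pow_eq_0:
  fixes g :: "'i set \<Rightarrow> real"
  assumes "finite I" "a \<in> I" "\<And>S. S \<subseteq> I - {a} \<Longrightarrow> g (insert a S) = g S"
  shows "(\<Sum>S\<in>Pow I. (-1) ^ card S * g S) = 0"
proof -
  let ?I = "I - {a}"
  have I: "Pow I = Pow ?I \<union> insert a ` Pow ?I"
    using Pow_insert[of a ?I] assms(2) by (simp add: insert_absorb)
  have "(\<Sum>S\<in>insert a ` Pow ?I. (-1) ^ card S * g S) =
      (\<Sum>S\<in>Pow ?I. (-1) ^ card (insert a S) * g (insert a S))"
    by (subst sum.reindex) (auto simp: inj_on_def)
  also have "\<dots> = (\<Sum>S\<in>Pow ?I. - ((-1) ^ card S * g S))"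
  proof (rule sum.cong[OF refl])
    fix S assume "S \<in> Pow ?I"
    then have "finite S" "a \<notin> S" using assms(1) finite_subset by auto
    then show "(-1) ^ card (insert a S) * g (insert a S) = - ((-1) ^ card S * g S)"
      using assms(3) \<open>S \<in> Pow ?I\<close> by simp
  qed
  finally have "(\<Sum>S\<in>insert a ` Pow ?I. (-1) ^ card S * g S) = - (\<Sum>S\<in>Pow ?I. (-1) ^ card S * g S)"
    by (simp add: sum_negf)
  moreover have "Pow ?I \<inter> insert a ` Pow ?I = {}" by auto
  ultimately show ?thesis
    unfolding I using assms(1) by (subst sum.union_disjoint) auto
qed

section \<open>Discrete subgroups: finiteness and the recursion for counts\<close>

locale discrete_subgroup =
  fixes L :: "'a::euclidean_space set"
  assumes subgroup: "int_module.subspace L" and discrete: "discrete L"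
begin

lemma zero_mem: "0 \<in> L"
  using subgroup by (simp add: int_module.subspace_def)

lemma add_mem: "x \<in> L \<Longrightarrow> y \<in> L \<Longrightarrow> x + y \<in> L"
  using subgroup by (simp add: int_module.subspace_def)

lemma diff_mem: "x \<in> L \<Longrightarrow> y \<in> L \<Longrightarrow> x - y \<in> L"
  using subgroup by (rule int_module.subspace_diff)

lemma scale_mem: "x \<in> L \<Longrightarrow> of_int k *\<^sub>R x \<in> L"
  using subgroup by (metis int_module.subspace_def int_scale_def)

lemma zspan_subset: "B \<subseteq> L \<Longrightarrow> int_module.span B \<subseteq> L"
  using subgroup by (rule int_module.span_minimal[rotated])

text \<open>Discreteness isolates points one at a time; passing to differences turns the isolation
  radius of \<open>0\<close> into a uniform one.\<close>

lemma finite_Int_bounded: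
  assumes "bounded B"
  shows "finite (L \<inter> B)"
proof -
  obtain d where d: "d > 0" "\<And>y. y \<in> L \<Longrightarrow> dist 0 y < d \<Longrightarrow> y = 0"
    using isolated_inE_dist[OF discreteD[OF discrete zero_mem]] by blast
  have "uniform_discrete L"
  proof (rule uniformI1[OF d(1)])
    fix x y assume "x \<in> L" "y \<in> L" "dist x y < d"
    then show "x = y" using d(2)[of "x - y"] diff_mem[of x y] by (simp add: dist_norm norm_minus_commute)
  qed
  then have "uniform_discrete (L \<inter> B)" by (rule uniform_discrete_subset) auto
  moreover have "bounded (L \<inter> B)" using assms by auto
  ultimately show ?thesis using uniform_discrete_finite_iff by blast
qed

lemma countable: "countable L"
proof -
  have "L = (\<Union>n. L \<inter> ball 0 (real n))"
    by (auto simp: reals_Archimedean2)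
  moreover have "countable (\<Union>n. L \<inter> ball 0 (real n))"
    by (rule countable_UN) (auto intro: countable_finite finite_Int_bounded)
  ultimately show ?thesis by simp
qed

text \<open>Removing the integer parts of the coefficients over \<open>B\<close> gives every hit
  coset a representative in one fixed ball, where \<open>L\<close> has only finitely many
  points.\<close>

lemma finite_hit_cosets:
  assumes "finite B" "B \<subseteq> L" "bounded Z"
  shows "finite (hit_cosets L B Z x)"
proof -
  obtain R where R: "\<And>z. z \<in> Z \<Longrightarrow> norm z \<le> R"
    using assms(3) by (auto simp: bounded_iff)
  define S where "S = L \<inter> cball 0 (norm x + R + (\<Sum>b\<in>B. norm b))"
  have "hit_cosets L B Z x \<subseteq> (\<lambda>l. (+) l ` int_module.span B) ` S"
  proof
    fix A assume "A \<in> hit_cosets L B Z x"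
    then obtain l where l: "l \<in> L" "x - l \<in> Z + span B" "A = (+) l ` int_module.span B"
      by (auto simp: hit_cosets_def)
    then obtain z h where zh: "z \<in> Z" "h \<in> span B" "x - l = z + h"
      by (auto elim: set_plus_elim)
    obtain c where c: "h = (\<Sum>b\<in>B. c b *\<^sub>R b)"
      using zh(2) span_finite[OF assms(1)] by auto
    define g where "g = (\<Sum>b\<in>B. int_scale \<lfloor>c b\<rfloor> b)"
    have g: "g \<in> int_module.span B"
      unfolding g_def
      by (intro int_module.span_sum int_module.span_scale int_module.span_base)
    have "x - (l + g) = z + (\<Sum>b\<in>B. frac (c b) *\<^sub>R b)"
      using zh(3) by (simp add: c g_def int_scale_def frac_def algebra_simps sum_subtractf)
    then have "l + g = x - z - (\<Sum>b\<in>B. frac (c b) *\<^sub>R b)"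
      by (simp add: algebra_simps)
    also have "norm \<dots> \<le> norm x + norm z + norm (\<Sum>b\<in>B. frac (c b) *\<^sub>R b)"
      by (meson norm_triangle_ineq4 order_trans add_right_mono)
    also have "norm (\<Sum>b\<in>B. frac (c b) *\<^sub>R b) \<le> (\<Sum>b\<in>B. norm b)"
    proof (rule order_trans[OF norm_sum sum_mono])
      fix b show "norm (frac (c b) *\<^sub>R b) \<le> norm b"
        using frac_lt_1[of "c b"] by (simp add: mult_left_le_one_le)
    qed
    finally have "l + g \<in> S"
      using R[OF zh(1)] l(1) g zspan_subset[OF assms(2)] by (auto simp: S_def intro: add_mem)
    moreover have "A = (+) (l + g) ` int_module.span B"
      unfolding l(3) zspan_translate_eq_iff using int_module.span_neg[OF g] by simp
    ultimately show "A \<in> (\<lambda>l. (+) l ` int_module.span B) ` S" by blast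
  qed
  moreover have "finite S" unfolding S_def by (intro finite_Int_bounded) auto
  ultimately show ?thesis by (meson finite_imageI finite_subset)
qed

text \<open>The newly hit cosets are matched with the cosets of the larger group that contain them:
  each larger coset hit by \<open>Z\<close> contains exactly one new coset, by
  \<open>unique_new_integer_point\<close> along \<open>v\<close>.\<close>

lemma card_hit_cosets_plus_segment:
  assumes B: "finite B" "B \<subseteq> L" and v: "v \<in> L" "v \<notin> span B"
    and Z: "compact Z" "convex Z"
  shows "card (hit_cosets L B (Z + closed_segment 0 v) x) =
         card (hit_cosets L B Z x) + card (hit_cosets L (insert v B) Z x)"
proof -
  let ?G = "int_module.span B" and ?G' = "int_module.span (insert v B)"
  let ?X = "Z + span B"
  have X: "Z + closed_segment 0 v + span B = ?X + closed_segment 0 v"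
    by (simp add: ac_simps)
  have sub: "hit_cosets L B Z x \<subseteq> hit_cosets L B (Z + closed_segment 0 v) x"
  proof -
    have "?X \<subseteq> ?X + closed_segment 0 v"
      using set_zero_plus2[of "closed_segment 0 v" ?X] by (simp add: add.commute)
    then show ?thesis by (auto simp: hit_cosets_def X)
  qed
  have fin: "finite (hit_cosets L B (Z + closed_segment 0 v) x)"
    by (intro finite_hit_cosets B compact_imp_bounded compact_set_plus Z) auto
  define D where "D = hit_cosets L B (Z + closed_segment 0 v) x - hit_cosets L B Z x"
  have D_iff: "(+) l ` ?G \<in> D \<longleftrightarrow> x - l \<in> ?X + closed_segment 0 v \<and> x - l \<notin> ?X"
    if "l \<in> L" for l
    using that by (simp add: D_def mem_hit_cosets_iff X)
  have D_rep: "\<exists>l\<in>L. A = (+) l ` ?G" if "A \<in> D" for A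
    using that by (auto simp: D_def hit_cosets_def)
  have hit': "x - l \<in> Z + span (insert v B) \<longleftrightarrow> (\<exists>t. x - l - t *\<^sub>R v \<in> ?X)" for l
  proof
    assume "x - l \<in> Z + span (insert v B)"
    then obtain z h where zh: "z \<in> Z" "h \<in> span (insert v B)" "x - l = z + h"
      by (auto elim: set_plus_elim)
    from zh(2) obtain t where "h - t *\<^sub>R v \<in> span B" by (auto simp: span_insert)
    moreover have "x - l - t *\<^sub>R v = z + (h - t *\<^sub>R v)" using zh(3) by simp
    ultimately show "\<exists>t. x - l - t *\<^sub>R v \<in> ?X" using zh(1) by (metis set_plus_intro)
  next
    assume "\<exists>t. x - l - t *\<^sub>R v \<in> ?X"
    then obtain t z h where zh: "z \<in> Z" "h \<in> span B" "x - l - t *\<^sub>R v = z + h"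
      by (auto elim: set_plus_elim)
    then have "x - l = z + (h + t *\<^sub>R v)" by (simp add: algebra_simps)
    moreover have "h + t *\<^sub>R v \<in> span (insert v B)"
      using zh(2) by (auto simp: span_insert intro!: exI[of _ t])
    ultimately show "x - l \<in> Z + span (insert v B)" using zh(1) by (metis set_plus_intro)
  qed
  have unique: "\<exists>!k::int. y - of_int k *\<^sub>R v \<in> ?X + closed_segment 0 v \<and> y - of_int k *\<^sub>R v \<notin> ?X"
    if "y - t0 *\<^sub>R v \<in> ?X" for y t0
  proof -
    obtain C where "\<And>t. y - t *\<^sub>R v \<in> ?X \<Longrightarrow> \<bar>t\<bar> \<le> C"
      using line_meets_cylinder_bounded[OF compact_imp_bounded[OF Z(1)] v(2)] by metis
    then show ?thesis
      using unique_new_integer_point[OF convex_plus_span[OF Z(2)] closed_plus_span[OF Z(1)] _ that]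
      by blast
  qed
  \<comment> \<open>Defined on cosets as sets, so that no representatives have to be chosen: it
    sends a coset of \<open>?G\<close> to the coset of \<open>?G'\<close> containing it.\<close>
  define \<pi> where "\<pi> A = A + ?G'" for A
  have GG: "?G + ?G' = ?G'"
  proof
    show "?G + ?G' \<subseteq> ?G'"
      using int_module.span_mono[of B "insert v B"]
      by (auto elim!: set_plus_elim intro!: int_module.span_add)
    show "?G' \<subseteq> ?G + ?G'"
      by (rule set_zero_plus2) (rule int_module.span_zero)
  qed
  have \<pi>: "\<pi> ((+) l ` ?G) = (+) l ` ?G'" for l
  proof -
    have "(+) l ` ?G + ?G' = (+) l ` (?G + ?G')"
      by (force simp: set_plus_def image_iff add.assoc)
    then show ?thesis by (simp add: \<pi>_def GG)
  qed
  have "bij_betw \<pi> D (hit_cosets L (insert v B) Z x)"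
    unfolding bij_betw_def
  proof (intro conjI inj_onI)
    fix A A' assume "A \<in> D" "A' \<in> D" and eq: "\<pi> A = \<pi> A'"
    then obtain l l' where l: "l \<in> L" "A = (+) l ` ?G" "l' \<in> L" "A' = (+) l' ` ?G"
      using D_rep by meson
    from eq have "l - l' \<in> ?G'"
      by (simp add: l \<pi> zspan_translate_eq_iff)
    \<comment> \<open>Modulo \<open>?G\<close> the representatives differ by \<open>k\<close> steps
      along \<open>v\<close>. Both \<open>k\<close> and \<open>0\<close> solve the uniqueness
      problem at \<open>x - l'\<close>, so \<open>k = 0\<close>.\<close>
    then obtain k :: int where k: "l - l' - of_int k *\<^sub>R v \<in> ?G"
      by (auto simp: int_module.span_insert int_scale_def)
    have cong: "x - l \<in> Y + span B \<longleftrightarrow> x - l' - of_int k *\<^sub>R v \<in> Y + span B" for Y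
    proof (rule mem_plus_span_cong)
      have "- (l - l' - of_int k *\<^sub>R v) \<in> span B"
        using k zspan_subset_span by (intro span_neg) auto
      then show "x - l - (x - l' - of_int k *\<^sub>R v) \<in> span B" by (simp add: algebra_simps)
    qed
    have 1: "x - l' - of_int k *\<^sub>R v \<in> ?X + closed_segment 0 v \<and> x - l' - of_int k *\<^sub>R v \<notin> ?X"
      using \<open>A \<in> D\<close> D_iff[OF l(1)] cong cong[of "Z + closed_segment 0 v"] l by (simp add: X)
    have 2: "x - l' - of_int 0 *\<^sub>R v \<in> ?X + closed_segment 0 v \<and> x - l' - of_int 0 *\<^sub>R v \<notin> ?X"
      using \<open>A' \<in> D\<close> D_iff[OF l(3)] l by simp
    obtain t0 where "x - l' - t0 *\<^sub>R v \<in> ?X"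
      using 2 by (auto simp: mem_segment_plus_iff)
    from unique[OF this] 1 2 have "k = 0" by blast
    with k show "A = A'" by (simp add: l zspan_translate_eq_iff)
  next
    show "\<pi> ` D = hit_cosets L (insert v B) Z x"
    proof (intro equalityI subsetI)
      fix C assume "C \<in> \<pi> ` D"
      then obtain l where l: "l \<in> L" "(+) l ` ?G \<in> D" "C = (+) l ` ?G'"
        using D_rep \<pi> by blast
      then obtain t where "x - l - t *\<^sub>R v \<in> ?X"
        using D_iff[OF l(1)] by (auto simp: mem_segment_plus_iff)
      then show "C \<in> hit_cosets L (insert v B) Z x"
        using l hit' by (auto simp: mem_hit_cosets_iff)
    next
      fix C assume "C \<in> hit_cosets L (insert v B) Z x"
      then obtain l where l: "l \<in> L" "x - l \<in> Z + span (insert v B)" "C = (+) l ` ?G'"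
        by (auto simp: hit_cosets_def)
      then obtain t where "x - l - t *\<^sub>R v \<in> ?X" using hit' by blast
      from unique[OF this] obtain k :: int where
        k: "x - l - of_int k *\<^sub>R v \<in> ?X + closed_segment 0 v" "x - l - of_int k *\<^sub>R v \<notin> ?X"
        by blast
      \<comment> \<open>Shifting by \<open>k\<close> steps stays in the larger coset and selects the
        new coset inside it.\<close>
      define l' where "l' = l + of_int k *\<^sub>R v"
      have l': "l' \<in> L" unfolding l'_def by (intro add_mem scale_mem l v)
      have "(+) l' ` ?G \<in> D"
        using k D_iff[OF l'] by (simp add: l'_def diff_diff_eq)
      moreover have "\<pi> ((+) l' ` ?G) = C"
        unfolding \<pi> l(3) zspan_translate_eq_iff l'_def
        using int_module.span_scale[of v "insert v B" k]
        by (simp add: int_module.span_base int_scale_def)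
      ultimately show "C \<in> \<pi> ` D" by blast
    qed
  qed
  then have "card (hit_cosets L (insert v B) Z x) = card D"
    using bij_betw_same_card by metis
  also have "\<dots> = card (hit_cosets L B (Z + closed_segment 0 v) x) - card (hit_cosets L B Z x)"
    unfolding D_def by (rule card_Diff_subset[OF finite_subset[OF sub fin] sub])
  finally show ?thesis
    using card_mono[OF fin sub] by simp
qed

section \<open>Multiplicities that are constant almost everywhere\<close>

lemma negligible_translates_span:
  assumes "span B \<noteq> UNIV"
  shows "negligible (\<Union>l\<in>L. (+) l ` span B)"
proof (intro negligible_countable_Union countable_image countable)
  have "dim (span B) < DIM('a)"
    using assms by (metis dim_eq_full dim_span dim_subset_UNIV le_neq_implies_less)
  then show "negligible A" if "A \<in> (\<lambda>l. (+) l ` span B) ` L" for A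
    using that negligible_translation[OF negligible_lowdim] by blast
qed

text \<open>Either \<open>B\<close> spans everything and every coset is hit, whatever
  \<open>x\<close> is, or the count vanishes off countably many translates of a proper
  subspace.\<close>

lemma hit_cosets_zero_ae_constant:
  "\<exists>c. negligible {x. card (hit_cosets L B {0} x) \<noteq> c}"
proof (cases "span B = UNIV")
  case True
  then have "card (hit_cosets L B {0} x) = card (hit_cosets L B {0} 0)" for x
    by (simp add: hit_cosets_def)
  then have "negligible {x. card (hit_cosets L B {0} x) \<noteq> card (hit_cosets L B {0} 0)}"
    by simp
  then show ?thesis by (rule exI)
next
  case False
  have "{x. card (hit_cosets L B {0} x) \<noteq> 0} \<subseteq> (\<Union>l\<in>L. (+) l ` span B)"
  proof
    fix x assume "x \<in> {x. card (hit_cosets L B {0} x) \<noteq> 0}"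
    then have "hit_cosets L B {0} x \<noteq> {}" by auto
    then obtain l where "l \<in> L" "x - l \<in> span B"
      by (auto simp: hit_cosets_def)
    moreover have "x = l + (x - l)" by simp
    ultimately show "x \<in> (\<Union>l\<in>L. (+) l ` span B)" by blast
  qed
  then show ?thesis
    using negligible_subset[OF negligible_translates_span[OF False]] by blast
qed

text \<open>The hypothesis ranges over all finite \<open>B\<close> because the recursion also calls
  on the count for \<open>insert v B\<close>.\<close>

lemma hit_cosets_plus_segment_ae_constant:
  assumes ae: "\<And>B. finite B \<Longrightarrow> B \<subseteq> L \<Longrightarrow> \<exists>c. negligible {x. card (hit_cosets L B Z x) \<noteq> c}"
    and v: "v \<in> L" and Z: "compact Z" "convex Z" and B: "finite B" "B \<subseteq> L"
  shows "\<exists>c. negligible {x. card (hit_cosets L B (Z + closed_segment 0 v) x) \<noteq> c}"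
proof (cases "v \<in> span B")
  case True
  then show ?thesis using ae[OF B] by (simp add: hit_cosets_absorb)
next
  case False
  obtain c where c: "negligible {x. card (hit_cosets L B Z x) \<noteq> c}"
    using ae[OF B] by blast
  obtain c' where c': "negligible {x. card (hit_cosets L (insert v B) Z x) \<noteq> c'}"
    using ae[of "insert v B"] B v by auto
  have "{x. card (hit_cosets L B (Z + closed_segment 0 v) x) \<noteq> c + c'} \<subseteq>
        {x. card (hit_cosets L B Z x) \<noteq> c} \<union> {x. card (hit_cosets L (insert v B) Z x) \<noteq> c'}"
    by (auto simp: card_hit_cosets_plus_segment[OF B v False Z])
  then show ?thesis
    using negligible_subset[OF negligible_Un[OF c c']] by blast
qed

lemma hit_cosets_plus_segment_sum_ae_constant:
  fixes u :: "'i \<Rightarrow> 'a"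
  assumes ae: "\<And>B. finite B \<Longrightarrow> B \<subseteq> L \<Longrightarrow> \<exists>c. negligible {x. card (hit_cosets L B Z x) \<noteq> c}"
    and Z: "compact Z" "convex Z"
    and J: "finite J" "u ` J \<subseteq> L" and B: "finite B" "B \<subseteq> L"
  shows "\<exists>c. negligible {x. card (hit_cosets L B (Z + (\<Sum>i\<in>J. closed_segment 0 (u i))) x) \<noteq> c}"
  using J B
proof (induction J arbitrary: B rule: finite_induct)
  case empty
  then show ?case using ae by simp
next
  case (insert a J)
  have "\<exists>c. negligible {x. card (hit_cosets L B
      ((Z + (\<Sum>i\<in>J. closed_segment 0 (u i))) + closed_segment 0 (u a)) x) \<noteq> c}"
    by (rule hit_cosets_plus_segment_ae_constant)
      (use insert Z in \<open>auto intro!: compact_set_plus compact_segment_sum convex_set_plus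
        convex_segment_sum\<close>)
  then show ?case using insert by (simp add: ac_simps)
qed


lemma finite_hits:
  assumes "bounded P"
  shows "finite {l \<in> L. y - l \<in> P}"
proof -
  obtain R where R: "\<And>p. p \<in> P \<Longrightarrow> norm p \<le> R"
    using assms by (auto simp: bounded_iff)
  have "{l \<in> L. y - l \<in> P} \<subseteq> L \<inter> cball y R"
    using R by (auto simp: dist_norm)
  then show ?thesis
    using finite_Int_bounded[OF bounded_cball] by (rule finite_subset)
qed

lemma card_hit_cosets_empty:
  "card (hit_cosets L {} Z x) = card {l \<in> L. x - l \<in> Z}"
  unfolding hit_cosets_def by (subst card_image) (auto simp: inj_on_def)

text \<open>One family of segments is added to \<open>{0}\<close>, then the other; finally
  \<open>B\<close> is taken empty, where cosets are single points and the count is the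
  multiplicity.\<close>

lemma zonotope_hits_ae_constant:
  fixes u :: "'i \<Rightarrow> 'a" and w :: "'j \<Rightarrow> 'a"
  assumes "finite I" "u ` I \<subseteq> L" "finite J" "w ` J \<subseteq> L"
  shows "\<exists>c. negligible {x. card {l \<in> L. x - l \<in>
    (\<Sum>i\<in>I. closed_segment 0 (u i)) + (\<Sum>j\<in>J. closed_segment 0 (w j))} \<noteq> c}"
proof -
  have "\<exists>c. negligible {x. card (hit_cosets L B ({0} + (\<Sum>i\<in>I. closed_segment 0 (u i))) x) \<noteq> c}"
    if "finite B" "B \<subseteq> L" for B
    by (rule hit_cosets_plus_segment_sum_ae_constant)
      (use assms that hit_cosets_zero_ae_constant in auto)
  then have "\<exists>c. negligible {x. card (hit_cosets L {} ((\<Sum>i\<in>I. closed_segment 0 (u i)) +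
      (\<Sum>j\<in>J. closed_segment 0 (w j))) x) \<noteq> c}"
    by (intro hit_cosets_plus_segment_sum_ae_constant)
      (use assms in \<open>auto simp: compact_segment_sum convex_segment_sum\<close>)
  then show ?thesis by (simp only: card_hit_cosets_empty)
qed

section \<open>Alternating sums of translates\<close>

text \<open>The segment changes each count by a coset count for \<open>{v a}\<close>, which does not
  feel the shift \<open>s a *\<^sub>R v a\<close>; hence these increments cancel between
  \<open>S\<close> and \<open>insert a S\<close>.\<close>

lemma alternating_hits_remove_segment:
  fixes v :: "'i \<Rightarrow> 'a"
  assumes I: "finite I" "a \<in> I" and v: "v a \<in> L" "v a \<noteq> 0" and Z: "compact Z" "convex Z"
  shows "(\<Sum>S\<in>Pow I. (-1) ^ card S *
            real (card {l \<in> L. x - (\<Sum>i\<in>S. s i *\<^sub>R v i) - l \<in> Z + closed_segment 0 (v a)})) =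
         (\<Sum>S\<in>Pow I. (-1) ^ card S * real (card {l \<in> L. x - (\<Sum>i\<in>S. s i *\<^sub>R v i) - l \<in> Z}))"
proof -
  define q where "q S = (\<Sum>i\<in>S. s i *\<^sub>R v i)" for S
  define g where "g S = real (card (hit_cosets L {v a} Z (x - q S)))" for S
  have split: "real (card {l \<in> L. y - l \<in> Z + closed_segment 0 (v a)}) =
      real (card {l \<in> L. y - l \<in> Z}) + real (card (hit_cosets L {v a} Z y))" for y
    using card_hit_cosets_plus_segment[of "{}" "v a" Z y] v Z
    by (simp add: card_hit_cosets_empty)
  have "g (insert a S) = g S" if "S \<subseteq> I - {a}" for S
  proof -
    have "finite S" "a \<notin> S" using that I finite_subset by auto
    then have "x - q S = (x - q (insert a S)) + s a *\<^sub>R v a"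
      by (simp add: q_def)
    moreover have "s a *\<^sub>R v a \<in> span {v a}"
      by (intro span_scale span_base) simp
    ultimately show ?thesis
      unfolding g_def by (metis hit_cosets_translate)
  qed
  then have "(\<Sum>S\<in>Pow I. (-1) ^ card S * g S) = 0"
    by (rule alternating_sum_Pow_eq_0[OF I])
  then show ?thesis
    unfolding q_def[symmetric] split distrib_left sum.distrib
    by (simp add: g_def)
qed

text \<open>Stripping off all segments leaves translates of the null set \<open>Z\<close>, and
  countably many of these cover every point with a nonzero count.\<close>

lemma alternating_hits_ae_zero:
  fixes v :: "'i \<Rightarrow> 'a"
  assumes I: "finite I" and v: "\<And>i. i \<in> I \<Longrightarrow> v i \<in> L \<and> v i \<noteq> 0"
    and Z: "compact Z" "convex Z" "negligible Z"
  shows "negligible {x. (\<Sum>S\<in>Pow I. (-1) ^ card S *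
     real (card {l \<in> L. x - (\<Sum>i\<in>S. s i *\<^sub>R v i) - l \<in> Z + (\<Sum>i\<in>I. closed_segment 0 (v i))})) \<noteq> 0}"
proof -
  define q where "q S = (\<Sum>i\<in>S. s i *\<^sub>R v i)" for S
  have reduce: "(\<Sum>S\<in>Pow I. (-1) ^ card S *
       real (card {l \<in> L. x - q S - l \<in> Z + (\<Sum>i\<in>J. closed_segment 0 (v i))})) =
     (\<Sum>S\<in>Pow I. (-1) ^ card S * real (card {l \<in> L. x - q S - l \<in> Z}))"
    if "J \<subseteq> I" for J x
    using finite_subset[OF that I] that
  proof (induction J rule: finite_induct)
    case (insert a J)
    have "Z + (\<Sum>i\<in>insert a J. closed_segment 0 (v i)) =
        (Z + (\<Sum>i\<in>J. closed_segment 0 (v i))) + closed_segment 0 (v a)"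
      using insert by (simp add: ac_simps)
    then show ?case
      using alternating_hits_remove_segment[OF I, of a v "Z + (\<Sum>i\<in>J. closed_segment 0 (v i))" x s]
        insert v Z
      by (simp add: q_def compact_set_plus compact_segment_sum convex_set_plus convex_segment_sum)
  qed simp
  let ?N = "\<Union>(S, l)\<in>Pow I \<times> L. (+) (q S + l) ` Z"
  have N: "negligible ?N"
    using I countable Z(3)
    by (intro negligible_countable_Union countable_image countable_SIGMA countable_finite[of "Pow I"])
      (auto intro: negligible_translation)
  have zero: "(\<Sum>S\<in>Pow I. (-1) ^ card S *
       real (card {l \<in> L. x - q S - l \<in> Z + (\<Sum>i\<in>I. closed_segment 0 (v i))})) = 0" if "x \<notin> ?N" for x
  proof -
    have empty: "{l \<in> L. x - q S - l \<in> Z} = {}" if "S \<in> Pow I" for S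
    proof -
      have "x \<in> ?N" if "l \<in> L" "x - q S - l \<in> Z" for l
      proof -
        have "x = (q S + l) + (x - q S - l)" by simp
        then have "x \<in> (+) (q S + l) ` Z" using that by blast
        then show ?thesis using \<open>S \<in> Pow I\<close> \<open>l \<in> L\<close> by blast
      qed
      then show ?thesis using \<open>x \<notin> ?N\<close> by blast
    qed
    show ?thesis
      unfolding reduce[OF subset_refl]
      by (rule sum.neutral) (metis empty card.empty of_nat_0 mult_zero_right)
  qed
  show ?thesis
    unfolding q_def[symmetric] by (rule negligible_subset[OF N]) (use zero in blast)
qed

text \<open>Links point counts to the infinite sum in \<open>covers_with_multiplicity\<close>: at a
  given \<open>x\<close>, the layer \<open>q + L\<close> has only finitely many nonzero
  terms.\<close>

lemma has_sum_translated_hits: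
  assumes "bounded P"
  shows "((\<lambda>l. of_bool (l - q \<in> L) * indicator ((+) l ` P) x :: real)
    has_sum real (card {l \<in> L. x - q - l \<in> P})) UNIV"
proof (rule has_sum_finite_neutralI[where B = "(+) q ` {l \<in> L. x - q - l \<in> P}"])
  have mem: "x \<in> (+) l ` P \<longleftrightarrow> x - l \<in> P" for l
    by (force simp: image_iff)
  show "finite ((+) q ` {l \<in> L. x - q - l \<in> P})"
    using finite_hits[OF assms] by simp
  show "of_bool (l - q \<in> L) * indicator ((+) l ` P) x = (0::real)"
    if "l \<in> UNIV - (+) q ` {l \<in> L. x - q - l \<in> P}" for l
  proof -
    have "l = q + (l - q)" "x - q - (l - q) = x - l" by simp_all
    then have "l - q \<notin> L \<or> x - l \<notin> P" using that by fastforce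
    then show ?thesis by (auto simp: mem indicator_def)
  qed
  show "real (card {l \<in> L. x - q - l \<in> P}) =
      (\<Sum>l\<in>(+) q ` {l \<in> L. x - q - l \<in> P}. of_bool (l - q \<in> L) * indicator ((+) l ` P) x)"
    by (subst sum.reindex) (simp_all add: mem diff_diff_eq indicator_def)
qed simp

section \<open>Integer rank against real dimension\<close>

text \<open>Pigeonhole: the cosets of the multiples of \<open>u\<close> all lie in
  \<open>span B\<close>, and only finitely many cosets do.\<close>

lemma multiple_mem_zspan:
  assumes "finite B" "B \<subseteq> L" "u \<in> L" "u \<in> span B"
  obtains k :: int where "k > 0" "int_scale k u \<in> int_module.span B"
proof -
  define c where "c n = (+) (of_int (int n) *\<^sub>R u) ` int_module.span B" for n :: nat
  have "c n \<in> hit_cosets L B {0} 0" for n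
  proof -
    have "of_int (int n) *\<^sub>R u \<in> L" using assms(3) by (rule scale_mem)
    moreover have "- (of_int (int n) *\<^sub>R u) \<in> span B"
      using assms(4) by (intro span_neg span_scale)
    ultimately show ?thesis by (auto simp: c_def mem_hit_cosets_iff)
  qed
  then have "finite (range c)"
    using finite_hit_cosets[OF assms(1,2) bounded_insert[THEN iffD2, OF bounded_empty], of 0 0]
    by (meson finite_subset image_subsetI)
  then have "\<not> inj c"
    using finite_imageD by fastforce
  then obtain a b where "a < b" "c b = c a"
    by (metis injI linorder_neqE_nat)
  then have "int_scale (int b - int a) u \<in> int_module.span B"
    by (simp add: c_def zspan_translate_eq_iff int_scale_def scaleR_diff_left)
  then show ?thesis
    using that[of "int b - int a"] \<open>a < b\<close> by simp
qed

text \<open>A basis element beyond a maximal real-independent subset has a positive multiple in the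
  integer span of that subset, which is a forbidden integer relation. Discreteness enters through
  \<open>multiple_mem_zspan\<close>.\<close>

lemma zbasis_not_subset_subspace:
  assumes B: "finite B" "int_module.independent B" "int_module.span B = L"
    and H: "subspace H" "dim H < card B"
  shows "\<not> L \<subseteq> H"
proof
  assume "L \<subseteq> H"
  have "B \<subseteq> L" using B int_module.span_superset by blast
  obtain B0 where B0: "B0 \<subseteq> B" "independent B0" "B \<subseteq> span B0"
    using maximal_independent_subset[of B] by metis
  have "card B0 \<le> dim H"
    using B0 \<open>B \<subseteq> L\<close> \<open>L \<subseteq> H\<close> by (intro independent_card_le_dim) auto
  then obtain b where b: "b \<in> B" "b \<notin> B0"
    using B0(1) H(2) by (metis linorder_not_less subsetI subset_antisym)
  obtain k :: int where k: "k > 0" "int_scale k b \<in> int_module.span B0"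
    using multiple_mem_zspan[of B0 b] B0 b B \<open>B \<subseteq> L\<close> finite_subset
    by (metis subset_iff subset_trans)
  then have "int_scale k b \<in> int_module.span (B - {b})"
    using int_module.span_mono[of B0 "B - {b}"] B0 b by blast
  then obtain f where f: "int_scale k b = (\<Sum>x\<in>B - {b}. int_scale (f x) x)"
    using int_module.span_finite[of "B - {b}"] B by auto
  define f' where "f' = f(b := - k)"
  have "(\<Sum>x\<in>B. int_scale (f' x) x) = int_scale (- k) b + (\<Sum>x\<in>B - {b}. int_scale (f' x) x)"
    using b B by (simp add: sum.remove f'_def)
  also have "(\<Sum>x\<in>B - {b}. int_scale (f' x) x) = (\<Sum>x\<in>B - {b}. int_scale (f x) x)"
    by (rule sum.cong) (auto simp: f'_def)
  finally have "(\<Sum>x\<in>B. int_scale (f' x) x) = 0"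
    unfolding f[symmetric] by (simp add: int_scale_def)
  moreover have "f' b \<noteq> 0" using k by (simp add: f'_def)
  ultimately have "int_module.dependent B"
    using int_module.dependent_finite[OF B(1)] b by blast
  with B(2) show False by simp
qed

end

section \<open>Generic coefficients and the exclusion of lattices\<close>

text \<open>The coefficients are chosen one at a time: as \<open>v a\<close> is nonzero, each subset
  of the earlier indices rules out only countably many reals.\<close>

lemma countable_generic_multiples:
  fixes v :: "'i \<Rightarrow> 'a::real_vector"
  assumes "countable L" "finite I" "\<And>i. i \<in> I \<Longrightarrow> v i \<noteq> 0"
  shows "\<exists>s. \<forall>S. S \<subseteq> I \<longrightarrow> S \<noteq> {} \<longrightarrow> (\<Sum>i\<in>S. s i *\<^sub>R v i) \<notin> L"
  using assms(2,3)
proof (induction I rule: finite_induct)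
  case (insert a I)
  then obtain s where s: "\<And>S. S \<subseteq> I \<Longrightarrow> S \<noteq> {} \<Longrightarrow> (\<Sum>i\<in>S. s i *\<^sub>R v i) \<notin> L"
    by auto
  define bad where "bad S = (\<lambda>t. t *\<^sub>R v a + (\<Sum>i\<in>S. s i *\<^sub>R v i)) -` L" for S
  have "countable (bad S)" for S
  proof -
    have "inj (\<lambda>t. t *\<^sub>R v a + (\<Sum>i\<in>S. s i *\<^sub>R v i))"
      using insert.prems[of a] by (auto simp: inj_on_def)
    moreover have "countable ((\<lambda>t. t *\<^sub>R v a + (\<Sum>i\<in>S. s i *\<^sub>R v i)) ` bad S)"
      by (rule countable_subset[OF _ assms(1)]) (auto simp: bad_def)
    ultimately show ?thesis
      using countable_image_inj_on inj_on_subset by blast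
  qed
  then have "countable (\<Union>S\<in>Pow I. bad S)"
    using insert(1) by (intro countable_UN countable_finite[of "Pow I"]) auto
  then obtain t where t: "\<And>S. S \<subseteq> I \<Longrightarrow> t \<notin> bad S"
    using uncountable_UNIV_real by (metis PowI UNIV_I UN_I countable_subset subsetI)
  define s' where "s' = s(a := t)"
  have s': "(\<Sum>i\<in>S. s' i *\<^sub>R v i) = (\<Sum>i\<in>S. s i *\<^sub>R v i)" if "S \<subseteq> I" for S
    using that insert(2) by (intro sum.cong) (auto simp: s'_def)
  have "(\<Sum>i\<in>S. s' i *\<^sub>R v i) \<notin> L" if S: "S \<subseteq> insert a I" "S \<noteq> {}" for S
  proof (cases "a \<in> S")
    case True
    have "(\<Sum>i\<in>S. s' i *\<^sub>R v i) = t *\<^sub>R v a + (\<Sum>i\<in>S - {a}. s i *\<^sub>R v i)"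
      using sum.remove[of S a "\<lambda>i. s' i *\<^sub>R v i"] True S insert(1) s'[of "S - {a}"]
        finite_subset[OF S(1)] by (auto simp: s'_def)
    moreover have "t \<notin> bad (S - {a})" using S by (intro t) auto
    ultimately show ?thesis by (simp add: bad_def)
  next
    case False
    then show ?thesis using s s' S by (metis subset_insert)
  qed
  then show ?case by blast
qed auto

lemma segment_sum_subset_subspace:
  assumes "subspace H" "\<And>i. i \<in> J \<Longrightarrow> u i \<in> H"
  shows "(\<Sum>i\<in>J. closed_segment 0 (u i)) \<subseteq> H"
  using assms(2)
proof (induction J rule: infinite_finite_induct)
  case (insert a J)
  have "closed_segment 0 (u a) \<subseteq> H"
    using insert assms(1) by (auto simp: closed_segment_def subspace_scale)
  then show ?case
    using insert assms(1) by (auto elim!: set_plus_elim intro!: subspace_add)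
qed (use assms(1) in \<open>auto simp: subspace_0\<close>)

lemma has_sum_finite_sum:
  fixes f :: "'i \<Rightarrow> 'b \<Rightarrow> real"
  assumes "finite A" "\<And>a. a \<in> A \<Longrightarrow> (f a has_sum c a) U"
  shows "((\<lambda>x. \<Sum>a\<in>A. f a x) has_sum (\<Sum>a\<in>A. c a)) U"
  using assms by (induction A rule: finite_induct) (auto intro: has_sum_add)

text \<open>\<open>Q\<close> stands for the odd shifts. The even layers are confined to
  \<open>H\<close>, so the multiples of a lattice vector outside \<open>H\<close> can only meet the
  translates of \<open>L\<close> by \<open>Q\<close>.\<close>

lemma not_union_of_lattices_if_swapped_layer:
  fixes L H Q :: "(real^3) set"
  assumes L: "discrete_subgroup L" and H: "subspace H" "dim H = 2" and Q: "finite Q" "Q \<inter> L = {}"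
    and pos0: "\<Lambda> 0 > 0"
    and off: "\<And>x. x \<notin> H \<Longrightarrow> \<Lambda> x > 0 \<Longrightarrow> \<exists>q\<in>Q. x - q \<in> L"
  shows "\<not> finite_union_of_translated_lattices \<Lambda>"
proof
  interpret L: discrete_subgroup L by (rule L)
  assume "finite_union_of_translated_lattices \<Lambda>"
  then obtain N t M where M: "\<And>i. i < (N::nat) \<Longrightarrow> is_lattice (M i)"
    and \<Lambda>: "\<And>x. \<Lambda> x = (\<Sum>i<N. indicator ((+) (t i) ` M i) x)"
    unfolding finite_union_of_translated_lattices_def by blast
  from pos0 obtain i where i: "i < N" "0 \<in> (+) (t i) ` M i"
    unfolding \<Lambda> by (metis (no_types, lifting) indicator_simps(2) lessThan_iff not_less_zero sum.neutral)
  interpret M: discrete_subgroup "M i"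
    using M[OF i(1)] by unfold_locales (auto simp: is_lattice_def)
  obtain B where B: "finite B" "card B = 3" "int_module.independent B" "int_module.span B = M i"
    using M[OF i(1)] by (auto simp: is_lattice_def has_free_rank_def)
  then obtain u where u: "u \<in> M i" "u \<notin> H"
    using M.zbasis_not_subset_subspace[of B H] H by auto
  \<comment> \<open>This translated lattice passes through the origin, so it is \<open>M i\<close>
    itself.\<close>
  have t: "- t i \<in> M i"
    using i(2) by (metis (no_types, lifting) add.inverse_inverse add_eq_0_iff imageE)
  \<comment> \<open>\<open>Suc\<close> skips the zero multiple, which lies in \<open>H\<close>; it
    also causes the index \<open>b - a - 1\<close> for the difference below.\<close>
  define x where "x n = of_int (int (Suc n)) *\<^sub>R u" for n
  have "\<exists>q\<in>Q. x n - q \<in> L" for n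
  proof (rule off)
    show "x n \<notin> H"
    proof
      assume "x n \<in> H"
      then have "(1 / of_int (int (Suc n))) *\<^sub>R x n \<in> H" using H(1) by (rule subspace_scale[rotated])
      then show False using u(2) by (simp add: x_def)
    qed
    have "x n \<in> M i" unfolding x_def using u(1) by (rule M.scale_mem)
    then have "x n + - t i \<in> M i" using t by (rule M.add_mem)
    moreover have "x n = t i + (x n + - t i)" by simp
    ultimately have "x n \<in> (+) (t i) ` M i" by blast
    then have "indicator ((+) (t i) ` M i) (x n) = (1::nat)" by simp
    moreover have "indicator ((+) (t i) ` M i) (x n) \<le> \<Lambda> (x n)"
      unfolding \<Lambda> using i(1) by (intro member_le_sum) auto
    ultimately show "\<Lambda> (x n) > 0" by simp
  qed
  then obtain q where q: "\<And>n. q n \<in> Q" "\<And>n. x n - q n \<in> L" by metis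
  have "\<not> inj q"
    using q(1) Q(1) by (metis finite_imageD finite_subset image_subsetI infinite_UNIV_nat)
  then obtain a b where ab: "a < b" "q a = q b"
    by (metis injI linorder_neqE_nat)
  have "(x b - q b) - (x a - q a) \<in> L" by (rule L.diff_mem[OF q(2) q(2)])
  moreover have "(x b - q b) - (x a - q a) = x (b - a - 1)"
    using ab by (simp add: x_def of_nat_diff flip: scaleR_diff_left)
  ultimately have "x (b - a - 1) \<in> L" by simp
  \<comment> \<open>The difference is the shift \<open>q (b - a - 1)\<close> itself, an element of
    \<open>Q\<close> that would lie in \<open>L\<close>.\<close>
  then have "x (b - a - 1) - (x (b - a - 1) - q (b - a - 1)) \<in> L"
    using q(2) L.diff_mem by blast
  then show False using q(1) Q(2) by auto
qed

section \<open>The tiling with exchanged layers\<close>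

theorem theorem7p1:
  fixes H\<^sub>1 H\<^sub>2 P :: "(real^3) set" and v w :: "nat \<Rightarrow> real^3" and n m :: nat
  assumes "subspace H\<^sub>1" "dim H\<^sub>1 = 2" "subspace H\<^sub>2" "dim H\<^sub>2 = 2" "H\<^sub>1 \<noteq> H\<^sub>2"
    and "\<And>i. i \<in> {1..n} \<Longrightarrow> v i \<in> H\<^sub>1"
    and "\<And>j. j \<in> {1..m} \<Longrightarrow> w j \<in> H\<^sub>2"
    and "P = two_family_zonotope n v m w"
    and "aff_dim P = 3"
    and "discrete (int_module.span (v ` {1..n} \<union> w ` {1..m}))"
    and "span (v ` {1..n}) = H\<^sub>1"
  shows "\<exists>(K::nat) (\<Lambda> :: real^3 \<Rightarrow> nat).
           K > 0 \<and> discrete_mult \<Lambda> \<and> covers_with_multiplicity P \<Lambda> K \<and>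
           \<not> finite_union_of_translated_lattices \<Lambda>"
proof -
  define L where "L = int_module.span (v ` {1..n} \<union> w ` {1..m})"
  define L1 where "L1 = int_module.span (v ` {1..n})"
  have L1_L: "L1 \<subseteq> L" unfolding L1_def L_def by (rule int_module.span_mono) auto
  have L1_H1: "L1 \<subseteq> H\<^sub>1" unfolding L1_def using zspan_subset_span assms(11) by blast
  interpret L: discrete_subgroup L
    using assms(10) by unfold_locales (auto simp: L_def int_module.subspace_span)
  interpret L1: discrete_subgroup L1
    using discrete_subset[OF L.discrete L1_L]
    by unfold_locales (auto simp: L1_def int_module.subspace_span)
  \<comment> \<open>Both the cancellation and the generic choice of \<open>s\<close> need nonzero
    vectors; a zero vector only adds the summand \<open>{0}\<close>.\<close>
  define I where "I = {i \<in> {1..n}. v i \<noteq> 0}"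
  define Z where "Z = (\<Sum>j\<in>{1..m}. closed_segment 0 (w j))"
  have I: "finite I" "\<And>i. i \<in> I \<Longrightarrow> v i \<noteq> 0" by (auto simp: I_def)
  have v: "v i \<in> L1" if "i \<in> {1..n}" for i
    using that by (auto simp: L1_def intro: int_module.span_base)
  have w: "w j \<in> L" if "j \<in> {1..m}" for j
    using that by (auto simp: L_def intro: int_module.span_base)
  have sumI: "(\<Sum>i\<in>{1..n}. closed_segment 0 (v i)) = (\<Sum>i\<in>I. closed_segment 0 (v i))"
    by (rule sum.mono_neutral_right) (auto simp: I_def)
  have P: "P = Z + (\<Sum>i\<in>I. closed_segment 0 (v i))"
    unfolding assms(8) two_family_zonotope_def Z_def sumI by (rule add.commute)
  have Z: "compact Z" "convex Z"
    unfolding Z_def by (rule compact_segment_sum convex_segment_sum)+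
  have "negligible Z"
  proof (rule negligible_subset)
    show "Z \<subseteq> H\<^sub>2" unfolding Z_def using assms(3,7) by (rule segment_sum_subset_subspace)
    show "negligible H\<^sub>2" using assms(4) by (intro negligible_lowdim) simp
  qed
  have cP: "compact P" "convex P"
    unfolding P by (auto intro: compact_set_plus compact_segment_sum convex_set_plus
        convex_segment_sum Z)
  then have bP: "bounded P" by (simp add: compact_imp_bounded)
  have "I \<noteq> {}"
  proof
    assume "I = {}"
    then have "v ` {1..n} \<subseteq> {0}" by (auto simp: I_def)
    then have "dim (v ` {1..n}) = 0" by (simp add: dim_eq_0)
    then show False using assms(2,11) by (metis dim_span zero_neq_numeral)
  qed
  obtain s where s: "\<And>S. S \<subseteq> I \<Longrightarrow> S \<noteq> {} \<Longrightarrow> (\<Sum>i\<in>S. s i *\<^sub>R v i) \<notin> L"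
    using countable_generic_multiples[of L I v, OF L.countable I] by blast
  define q where "q S = (\<Sum>i\<in>S. s i *\<^sub>R v i)" for S
  define Odd where "Odd = {S \<in> Pow I. odd (card S)}"
  define Even where "Even = {S \<in> Pow I. even (card S)}"
  have fin: "finite Odd" "finite Even" using I(1) by (auto simp: Odd_def Even_def)
  have Pow_I: "Pow I = Odd \<union> Even" "Odd \<inter> Even = {}" by (auto simp: Odd_def Even_def)
  have "Odd \<noteq> {}"
  proof -
    obtain a where "a \<in> I" using \<open>I \<noteq> {}\<close> by blast
    then have "{a} \<in> Odd" by (simp add: Odd_def)
    then show ?thesis by blast
  qed
  \<comment> \<open>Odd translates of \<open>L\<close> lose their layer \<open>L1\<close>, and even
    shifts supply that layer alone. The set difference keeps the definition within the
    naturals.\<close>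
  define \<Lambda> :: "real^3 \<Rightarrow> nat" where
    "\<Lambda> x = (\<Sum>S\<in>Odd. of_bool (x - q S \<in> L - L1)) + (\<Sum>S\<in>Even. of_bool (x - q S \<in> L1))" for x
  have \<Lambda>_pos: "\<Lambda> x > 0 \<longleftrightarrow> (\<exists>S\<in>Odd. x - q S \<in> L - L1) \<or> (\<exists>S\<in>Even. x - q S \<in> L1)" for x
    using fin by (auto simp: \<Lambda>_def sum_nonneg_eq_0_iff simp flip: neq0_conv)
  \<comment> \<open>Over the reals this is the union of the full odd translates plus a signed sum of
    exactly the form treated by \<open>alternating_hits_ae_zero\<close>.\<close>
  have \<Lambda>_real: "real (\<Lambda> x) = (\<Sum>S\<in>Odd. of_bool (x - q S \<in> L)) +
      (\<Sum>S\<in>Pow I. (-1) ^ card S * of_bool (x - q S \<in> L1))" for x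
  proof -
    have "(\<Sum>S\<in>Pow I. (-1) ^ card S * of_bool (x - q S \<in> L1)) =
        (\<Sum>S\<in>Odd. - of_bool (x - q S \<in> L1)) + (\<Sum>S\<in>Even. of_bool (x - q S \<in> L1) :: real)"
      unfolding Pow_I(1) sum.union_disjoint[OF fin Pow_I(2)]
      by (intro arg_cong2[where f = "(+)"] sum.cong) (auto simp: Odd_def Even_def)
    moreover have "(\<Sum>S\<in>Odd. of_bool (x - q S \<in> L - L1)) =
        (\<Sum>S\<in>Odd. of_bool (x - q S \<in> L)) + (\<Sum>S\<in>Odd. - of_bool (x - q S \<in> L1) :: real)"
      unfolding sum.distrib[symmetric] using L1_L by (intro sum.cong) auto
    ultimately show ?thesis by (simp add: \<Lambda>_def)
  qed
  obtain c where c: "negligible {x. card {l \<in> L. x - l \<in> P} \<noteq> c}"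
  proof -
    have "v ` I \<subseteq> L" "w ` {1..m} \<subseteq> L" using v w L1_L by (auto simp: I_def)
    then show thesis
      using that L.zonotope_hits_ae_constant[of "{1..m}" w I v] I(1)
      unfolding P Z_def by blast
  qed
  \<comment> \<open>Every point of \<open>P\<close> is hit by \<open>0\<close>, so
    \<open>c = 0\<close> would make the full-dimensional convex set \<open>P\<close> null.\<close>
  have "c \<noteq> 0"
  proof
    assume "c = 0"
    have "P \<subseteq> {x. card {l \<in> L. x - l \<in> P} \<noteq> c}"
    proof
      fix x assume "x \<in> P"
      then have "0 \<in> {l \<in> L. x - l \<in> P}" using L.zero_mem by simp
      then show "x \<in> {x. card {l \<in> L. x - l \<in> P} \<noteq> c}"
        using L.finite_hits[OF bP, of x] \<open>c = 0\<close> by (auto simp: card_eq_0_iff)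
    qed
    then have "interior P = {}"
      using negligible_convex_interior[OF cP(2)] negligible_subset[OF c] by blast
    moreover have "interior P = rel_interior P"
      using assms(9) by (intro interior_rel_interior[symmetric] | simp)+
    ultimately have "P = {}" using rel_interior_eq_empty[OF cP(2)] by simp
    then show False using assms(9) by simp
  qed
  \<comment> \<open>Each odd translate of \<open>L\<close> covers \<open>c\<close> times, and the
    exchange of layers contributes nothing almost everywhere.\<close>
  define K where "K = card Odd * c"
  have "K > 0" using \<open>c \<noteq> 0\<close> \<open>Odd \<noteq> {}\<close> fin by (simp add: K_def card_gt_0_iff)
  moreover have "discrete_mult \<Lambda>"
    unfolding discrete_mult_def
  proof (intro allI impI)
    fix B :: "(real^3) set" assume "bounded B"
    have "{x \<in> B. \<Lambda> x > 0} \<subseteq> (\<Union>S\<in>Pow I. (+) (q S) ` (L \<inter> (\<lambda>x. x - q S) ` B))"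
    proof
      fix x assume "x \<in> {x \<in> B. \<Lambda> x > 0}"
      then obtain S where "S \<in> Pow I" "x - q S \<in> L" "x \<in> B"
        using L1_L by (auto simp: \<Lambda>_pos Pow_I)
      moreover have "x = q S + (x - q S)" by simp
      ultimately show "x \<in> (\<Union>S\<in>Pow I. (+) (q S) ` (L \<inter> (\<lambda>x. x - q S) ` B))" by blast
    qed
    moreover have "finite (\<Union>S\<in>Pow I. (+) (q S) ` (L \<inter> (\<lambda>x. x - q S) ` B))"
      using I(1) \<open>bounded B\<close>
      by (intro finite_UN_I finite_imageI L.finite_Int_bounded) (auto intro: bounded_translation_minus)
    ultimately show "finite {x \<in> B. \<Lambda> x > 0}" by (rule finite_subset)
  qed
  moreover have "covers_with_multiplicity P \<Lambda> K"
  proof -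
    \<comment> \<open>\<open>?N1\<close> holds the points where the cancellation fails,
      \<open>?N2\<close> those where some odd translate does not cover exactly \<open>c\<close>
      times.\<close>
    let ?N1 = "{x. (\<Sum>S\<in>Pow I. (-1) ^ card S * real (card {l \<in> L1. x - q S - l \<in> P})) \<noteq> 0}"
    let ?N2 = "\<Union>S\<in>Odd. (+) (q S) ` {x. card {l \<in> L. x - l \<in> P} \<noteq> c}"
    have "negligible ?N1"
      unfolding P q_def
    proof (rule L1.alternating_hits_ae_zero[OF I(1) _ Z \<open>negligible Z\<close>])
      show "v i \<in> L1 \<and> v i \<noteq> 0" if "i \<in> I" for i
        using that v by (simp add: I_def)
    qed
    moreover have "negligible ?N2"
      using fin c by (intro negligible_Union) (auto intro: negligible_translation)
    ultimately have "negligible (?N1 \<union> ?N2)" by (rule negligible_Un)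
    moreover have "((\<lambda>l. real (\<Lambda> l) * indicator ((+) l ` P) x) has_sum real K) UNIV"
      if x: "x \<notin> ?N1 \<union> ?N2" for x
    proof -
      have c_eq: "card {l \<in> L. x - q S - l \<in> P} = c" if "S \<in> Odd" for S
      proof (rule ccontr)
        assume "\<not> ?thesis"
        moreover have "x = q S + (x - q S)" by simp
        ultimately have "x \<in> ?N2" using that by blast
        then show False using x by blast
      qed
      have "((\<lambda>l. (\<Sum>S\<in>Odd. of_bool (l - q S \<in> L) * indicator ((+) l ` P) x) +
          (\<Sum>S\<in>Pow I. (-1) ^ card S * (of_bool (l - q S \<in> L1) * indicator ((+) l ` P) x)))
        has_sum ((\<Sum>S\<in>Odd. real (card {l \<in> L. x - q S - l \<in> P})) +
          (\<Sum>S\<in>Pow I. (-1) ^ card S * real (card {l \<in> L1. x - q S - l \<in> P})))) UNIV"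
        using fin I(1) bP
        by (intro has_sum_add has_sum_finite_sum has_sum_cmult_right
            L.has_sum_translated_hits L1.has_sum_translated_hits) auto
      moreover have "(\<Sum>S\<in>Odd. real (card {l \<in> L. x - q S - l \<in> P})) +
          (\<Sum>S\<in>Pow I. (-1) ^ card S * real (card {l \<in> L1. x - q S - l \<in> P})) = real K"
        using x by (simp add: c_eq K_def)
      ultimately show ?thesis
        by (simp add: \<Lambda>_real distrib_right sum_distrib_right mult.assoc)
    qed
    ultimately show ?thesis
      unfolding covers_with_multiplicity_def
      by (intro AE_I'[where N = "?N1 \<union> ?N2"]) (auto simp: negligible_iff_null_sets)
  qed
  moreover have "\<not> finite_union_of_translated_lattices \<Lambda>"
  proof (rule not_union_of_lattices_if_swapped_layer[of L "H\<^sub>1" "q ` Odd"])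
    have "q S \<notin> L" if "S \<in> Odd" for S
      unfolding q_def using that by (intro s) (auto simp: Odd_def)
    then show "q ` Odd \<inter> L = {}" by blast
    \<comment> \<open>The empty index set is even and has shift \<open>0\<close>, so its layer
      \<open>L1\<close> brings in the origin.\<close>
    have "{} \<in> Even" "0 - q {} \<in> L1" by (auto simp: Even_def q_def L1.zero_mem)
    then show "\<Lambda> 0 > 0" unfolding \<Lambda>_pos by blast
    show "\<exists>y\<in>q ` Odd. x - y \<in> L" if "x \<notin> H\<^sub>1" "\<Lambda> x > 0" for x
    proof -
      \<comment> \<open>For even \<open>S\<close> both the shift \<open>q S\<close> and the layer
        \<open>L1\<close> lie in \<open>H\<^sub>1\<close>, so only odd terms survive off that
        plane.\<close>
      have "x - q S \<notin> L1" if "S \<in> Even" for S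
      proof
        assume "x - q S \<in> L1"
        moreover have "q S \<in> H\<^sub>1"
          unfolding q_def using that assms(1,6)
          by (intro subspace_sum subspace_scale) (auto simp: Even_def I_def)
        ultimately have "(x - q S) + q S \<in> H\<^sub>1" using L1_H1 assms(1) by (intro subspace_add) auto
        then show False using \<open>x \<notin> H\<^sub>1\<close> by simp
      qed
      then show ?thesis using \<open>\<Lambda> x > 0\<close> by (auto simp: \<Lambda>_pos)
    qed
  qed (use fin assms L.discrete_subgroup_axioms in auto)
  ultimately show ?thesis by blast
qed

end
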